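(* Let $n\ge 2$ and let $H_n=[h_{ij}]$ be the $n\times n$ tridiagonal matrix with $h_{11}=3$, $h_{ii}=1$ for $2\le i\le n$, $h_{i+1,i}=1$ and $h_{i,i+1}=2$ for $1\le i\le n-1$, and all other entries $0$. Define $H_n^{(0)}=H_n$ and, for $1\le r\le n-2$, let $H_n^{(r)}$ be the contraction of $H_n^{(r-1)}$ on column $1$ relative to rows $1$ and $2$. Then $$\operatorname{per}H_n=\operatorname{per}H_n^{(n-2)}=J_{n+2},$$ where $J_m$ denotes the $m$th Jacobsthal number.
   Context: The Jacobsthal numbers are defined by $J_0=0$, $J_1=1$, $J_{m+2}=J_{m+1}+2J_m$ for $m\ge 0$. The permanent of an $n\times n$ matrix $A=[a_{ij}]$ is $\operatorname{per}A=\sum_{\sigma\in S_n}\prod_{i=1}^n a_{i\sigma(i)}$. Contraction: if column $k$ of a matrix $A$ (with rows $r_1,\dots,r_m$) contains exactly two nonzero entries $a_{ik}$ and $a_{jk}$ ($i\ne j$), the contraction of $A$ on column $k$ relative to rows $i$ and $j$ is the $(m-1)\times(n-1)$ matrix obtained from $A$ by replacing row $i$ with $a_{jk}r_i+a_{ik}r_j$ and deleting row $j$ and column $k$. ($H_n$ is the adjacency matrix of a certain directed pseudo graph.) *)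

theory Defs
  imports "Jordan_Normal_Form.Determinant"
begin

text \<open>Matrix indices start at 0, so the first column is column 0 and the first two rows are
  rows 0 and 1.\<close>

fun jacobsthal :: "nat \<Rightarrow> nat" where
  "jacobsthal 0 = 0"
| "jacobsthal (Suc 0) = 1"
| "jacobsthal (Suc (Suc m)) = jacobsthal (Suc m) + 2 * jacobsthal m"

text \<open>As for \<^const>\<open>det\<close>, non-square matrices get the dummy value 0.\<close>

definition permanent :: "'a mat \<Rightarrow> 'a :: comm_semiring_1" where
  "permanent A = (if dim_row A = dim_col A
     then (\<Sum>p \<in> {p. p permutes {0..<dim_row A}}. \<Prod>i = 0..<dim_row A. A $$ (i, p i))
     else 0)"

definition contractible :: "'a :: comm_semiring_1 mat \<Rightarrow> nat \<Rightarrow> nat \<Rightarrow> nat \<Rightarrow> bool" where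
  "contractible A k i j \<longleftrightarrow>
     k < dim_col A \<and> i \<noteq> j \<and> {l. l < dim_row A \<and> A $$ (l, k) \<noteq> 0} = {i, j}"

text \<open>Meaningful only if \<^term>\<open>contractible A k i j\<close> holds.\<close>

definition contraction :: "'a :: comm_semiring_1 mat \<Rightarrow> nat \<Rightarrow> nat \<Rightarrow> nat \<Rightarrow> 'a mat" where
  "contraction A k i j = mat_delete
     (mat (dim_row A) (dim_col A) (\<lambda>(l, c).
        if l = i then A $$ (j, k) * A $$ (i, c) + A $$ (i, k) * A $$ (j, c)
        else A $$ (l, c))) j k"

definition H_mat :: "nat \<Rightarrow> int mat" where
  "H_mat n = mat n n (\<lambda>(i, j).
     if i = 0 \<and> j = 0 then 3
     else if i = j then 1
     else if i = Suc j then 1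
     else if j = Suc i then 2
     else 0)"

primrec H_contr :: "nat \<Rightarrow> nat \<Rightarrow> int mat" where
  "H_contr n 0 = H_mat n"
| "H_contr n (Suc r) = contraction (H_contr n r) 0 0 1"

end

theory Submission
  imports Defs
begin

text \<open>Contraction preserves the permanent of a square matrix. A permutation contributes only if it
  sends row \<open>i\<close> or row \<open>j\<close> to column \<open>k\<close>, and the terms of the first kind become terms of the second
  kind, with row \<open>j\<close> in place of row \<open>i\<close>, after composing the permutation with the transposition of
  \<open>i\<close> and \<open>j\<close>; together they make up the expansion of the permanent of the contraction.
  A tridiagonal matrix that agrees with \<^term>\<open>H_mat n\<close> except for leading entries \<open>a\<close>, \<open>b\<close> in its
  first row contracts to a smaller one with leading entries \<open>a + b\<close>, \<open>2 * a\<close>. Starting from 3, 2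
  this is the Jacobsthal recurrence.\<close>

text \<open>The unsigned analogue of a cofactor: \<open>permutation_insert i j\<close> maps the
  permutations of \<open>{0..<m}\<close> bijectively onto those of \<open>{0..<Suc m}\<close>
  sending \<open>i\<close> to \<open>j\<close>, and \<open>insert_index i\<close> enumerates the
  rows other than \<open>i\<close>.\<close>

lemma permanent_mat_delete:
  fixes A :: "'a :: comm_semiring_1 mat"
  assumes A: "A \<in> carrier_mat n n" and i: "i < n" and j: "j < n"
  shows "permanent (mat_delete A i j) =
    (\<Sum>p | p permutes {0..<n} \<and> p i = j. \<Prod>l \<in> {0..<n} - {i}. A $$ (l, p l))"
proof -
  obtain m where n: "n = Suc m" using i by (cases n) auto
  have prod_eq: "(\<Prod>l \<in> {0..<n} - {i}. A $$ (l, permutation_insert i j q l)) =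
      (\<Prod>l = 0..<m. mat_delete A i j $$ (l, q l))" if q: "q permutes {0..<m}" for q
  proof -
    have "(\<Prod>l \<in> {0..<n} - {i}. A $$ (l, permutation_insert i j q l)) =
        (\<Prod>l \<in> insert_index i ` {0..<m}. A $$ (l, permutation_insert i j q l))"
      using i by (simp add: n insert_index_image)
    also have "\<dots> = (\<Prod>l = 0..<m. A $$ (insert_index i l,
        permutation_insert i j q (insert_index i l)))"
      by (subst prod.reindex[OF insert_index_inj_on]) simp
    also have "\<dots> = (\<Prod>l = 0..<m. A $$ (insert_index i l, insert_index j (q l)))"
      by (intro prod.cong) (auto simp: permutation_insert_expand insert_index_def)
    also have "\<dots> = (\<Prod>l = 0..<m. mat_delete A i j $$ (l, q l))"
    proof (intro prod.cong refl)
      fix l assume "l \<in> {0..<m}"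
      then show "A $$ (insert_index i l, insert_index j (q l)) = mat_delete A i j $$ (l, q l)"
        using A i j permutes_in_image[OF q, of l] by (intro mat_delete_index) (auto simp: n)
    qed
    finally show ?thesis .
  qed
  have "(\<Sum>p | p permutes {0..<n} \<and> p i = j. \<Prod>l \<in> {0..<n} - {i}. A $$ (l, p l)) =
      (\<Sum>q | q permutes {0..<m}.
        \<Prod>l \<in> {0..<n} - {i}. A $$ (l, permutation_insert i j q l))"
    using i j by (simp only: n permutation_fix sum.reindex[OF permutation_insert_inj_on] o_def)
  also have "\<dots> = (\<Sum>q | q permutes {0..<m}. \<Prod>l = 0..<m. mat_delete A i j $$ (l, q l))"
    by (intro sum.cong) (auto simp: prod_eq)
  also have "\<dots> = permanent (mat_delete A i j)"
    using A by (simp add: permanent_def n)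
  finally show ?thesis by simp
qed

lemma permanent_contraction:
  fixes A :: "'a :: comm_semiring_1 mat"
  assumes sq: "dim_row A = dim_col A" and con: "contractible A k i j"
  shows "permanent (contraction A k i j) = permanent A"
proof -
  define n where "n = dim_row A"
  have A: "A \<in> carrier_mat n n" using sq by (auto simp: n_def)
  have supp: "{l. l < n \<and> A $$ (l, k) \<noteq> 0} = {i, j}" and k: "k < n" and neq: "i \<noteq> j"
    using con A by (auto simp: contractible_def)
  have i: "i < n" and j: "j < n" using supp by auto
  have zero: "A $$ (l, k) = 0" if "l < n" "l \<noteq> i" "l \<noteq> j" for l using supp that by auto
  define S where "S = {p. p permutes {0..<n}}"
  define R where "R = {0..<n} - {i, j}"
  define f where "f = (\<lambda>p. \<Prod>l \<in> R. A $$ (l, p l))"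
  let ?Si = "{p \<in> S. p i = k}" and ?Sj = "{p \<in> S. p j = k}"
  have finS: "finite S" unfolding S_def by (rule finite_permutations) simp
  have R: "finite R" "i \<notin> R" "j \<notin> R" "{0..<n} = insert i (insert j R)"
    "{0..<n} - {j} = insert i R" using i j neq by (auto simp: R_def)
  have prod_split: "(\<Prod>l = 0..<n. A $$ (l, p l)) = A $$ (i, p i) * (A $$ (j, p j) * f p)" for p
    using R neq by (simp add: f_def)

  have vanish: "(\<Prod>l = 0..<n. A $$ (l, p l)) = 0" if p: "p \<in> S - (?Si \<union> ?Sj)" for p
  proof -
    have "p permutes {0..<n}" using p by (simp add: S_def)
    \<comment> \<open>Surjectivity of \<open>p\<close> gives a row sent to column \<open>k\<close>.
      By the choice of \<open>p\<close> it is neither \<open>i\<close> nor \<open>j\<close>, so its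
      entry in that column is 0.\<close>
    then obtain l where l: "l < n" "p l = k"
      using k permutes_image[of p "{0..<n}"]
      by (metis atLeastLessThan_iff imageE zero_le)
    then have "A $$ (l, p l) = 0" using p zero by auto
    then show ?thesis using l(1) by (intro prod_zero) auto
  qed
  have disj: "?Si \<inter> ?Sj = {}"
    using neq by (auto simp: S_def) (metis permutes_inj injD)
  have "permanent A = (\<Sum>p \<in> S. \<Prod>l = 0..<n. A $$ (l, p l))"
    using A by (simp add: permanent_def S_def)
  also have "\<dots> = (\<Sum>p \<in> ?Si \<union> ?Sj. \<Prod>l = 0..<n. A $$ (l, p l))"
    using finS vanish by (intro sum.mono_neutral_right) auto
  also have "\<dots> = (\<Sum>p \<in> ?Si. \<Prod>l = 0..<n. A $$ (l, p l)) + (\<Sum>p \<in> ?Sj. \<Prod>l = 0..<n. A $$ (l, p l))"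
    using finS disj by (intro sum.union_disjoint) auto
  also have "\<dots> = (\<Sum>p \<in> ?Si. A $$ (i, k) * (A $$ (j, p j) * f p)) +
      (\<Sum>p \<in> ?Sj. A $$ (j, k) * (A $$ (i, p i) * f p))"
    unfolding prod_split by (intro arg_cong2[where f = "(+)"] sum.cong) (auto simp: ac_simps)
  also have "(\<Sum>p \<in> ?Si. A $$ (i, k) * (A $$ (j, p j) * f p)) =
      (\<Sum>p \<in> ?Sj. A $$ (i, k) * (A $$ (j, p i) * f p))"
  proof (rule sum.reindex_bij_witness[where i = "\<lambda>p. p \<circ> transpose i j"
        and j = "\<lambda>p. p \<circ> transpose i j"])
    have mem: "p \<circ> transpose i j \<in> S" if "p \<in> S" for p
      using that i j by (auto simp: S_def intro!: permutes_compose permutes_swap_id)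
    show "p \<circ> transpose i j \<in> ?Sj" if "p \<in> ?Si" for p using that mem by auto
    show "p \<circ> transpose i j \<in> ?Si" if "p \<in> ?Sj" for p using that mem by auto
    \<comment> \<open>The transposition fixes every row in \<open>R\<close>.\<close>
    have "f (p \<circ> transpose i j) = f p" for p
      unfolding f_def using R by (intro prod.cong) (auto simp: transpose_def)
    then show "A $$ (i, k) * (A $$ (j, (p \<circ> transpose i j) i) * f (p \<circ> transpose i j)) =
        A $$ (i, k) * (A $$ (j, p j) * f p)" for p by simp
  qed (simp_all add: comp_assoc)
  also have "\<dots> + (\<Sum>p \<in> ?Sj. A $$ (j, k) * (A $$ (i, p i) * f p)) =
      (\<Sum>p \<in> ?Sj. (A $$ (j, k) * A $$ (i, p i) + A $$ (i, k) * A $$ (j, p i)) * f p)"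
    by (simp add: sum.distrib[symmetric] algebra_simps)
  finally have perA: "permanent A = \<dots>" .

  define M where "M = mat n n (\<lambda>(l, c).
        if l = i then A $$ (j, k) * A $$ (i, c) + A $$ (i, k) * A $$ (j, c)
        else A $$ (l, c))"
  have "permanent (contraction A k i j) = permanent (mat_delete M j k)"
    using A by (simp add: contraction_def M_def)
  also have "\<dots> = (\<Sum>p | p permutes {0..<n} \<and> p j = k. \<Prod>l \<in> {0..<n} - {j}. M $$ (l, p l))"
    using j k by (intro permanent_mat_delete) (auto simp: M_def)
  also have "\<dots> = (\<Sum>p \<in> ?Sj. (A $$ (j, k) * A $$ (i, p i) + A $$ (i, k) * A $$ (j, p i)) * f p)"
  proof (intro sum.cong)
    fix p assume "p \<in> ?Sj"
    \<comment> \<open>Entries of \<open>M\<close> can be evaluated only at indices within its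
      dimensions.\<close>
    then have lt: "p l < n" if "l < n" for l
      using that permutes_in_image[of p "{0..<n}" l] by (simp add: S_def)
    have "(\<Prod>l \<in> R. M $$ (l, p l)) = f p"
      unfolding f_def using lt by (intro prod.cong) (auto simp: M_def R_def)
    then show "(\<Prod>l \<in> {0..<n} - {j}. M $$ (l, p l)) =
        (A $$ (j, k) * A $$ (i, p i) + A $$ (i, k) * A $$ (j, p i)) * f p"
      using R(1,2,5) i lt by (simp add: M_def)
  qed (simp add: S_def)
  finally show ?thesis using perA by simp
qed

text \<open>A family closed under the contraction used here, so that only two parameters need
  tracking. For \<open>n = 1\<close> the value \<open>b\<close> falls outside the matrix.\<close>

definition tri_mat :: "nat \<Rightarrow> int \<Rightarrow> int \<Rightarrow> int mat" where
  "tri_mat n a b = mat n n (\<lambda>(i, j).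
     if i = 0 \<and> j = 0 then a
     else if i = 0 \<and> j = 1 then b
     else if i = j then 1
     else if i = Suc j then 1
     else if j = Suc i then 2
     else 0)"

lemma H_mat_eq_tri_mat: "H_mat n = tri_mat n 3 2"
  by (rule eq_matI) (auto simp: H_mat_def tri_mat_def)

lemma contractible_tri_mat:
  assumes "n \<ge> 2" "a \<noteq> 0"
  shows "contractible (tri_mat n a b) 0 0 1"
  using assms by (auto simp: contractible_def tri_mat_def split: if_splits)

text \<open>The first two rows begin \<open>a, b, 0\<close> and \<open>1, 1, 2\<close>. The new row
  is the first plus \<open>a\<close> times the second, which begins \<open>a + b, 2 * a\<close> once
  column 0 is gone. The later rows only shift.\<close>

lemma contraction_tri_mat:
  assumes "n \<ge> 1"
  shows "contraction (tri_mat (Suc n) a b) 0 0 1 = tri_mat n (a + b) (2 * a)"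
  using assms by (intro eq_matI) (auto simp: contraction_def tri_mat_def mat_delete_def)

lemma permanent_tri_mat_1: "permanent (tri_mat 1 a b) = a"
proof -
  have "{p. p permutes {0..<1::nat}} = {id}" by auto
  then show ?thesis by (simp add: permanent_def tri_mat_def)
qed

text \<open>Keeps the leading entry of each contracted matrix nonzero, as contractibility
  requires.\<close>

lemma jacobsthal_Suc_pos: "jacobsthal (Suc m) > 0"
  by (induction m) auto

text \<open>The start is \<open>3 = jacobsthal 3\<close> and \<open>2 = 2 * jacobsthal 2\<close>;
  each contraction adds the two parameters, which is one step of the recurrence.\<close>

lemma H_contr_eq_tri_mat:
  assumes "r < n"
  shows "H_contr n r = tri_mat (n - r) (jacobsthal (r + 3)) (2 * jacobsthal (r + 2))"
  using assms
proof (induction r)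
  case 0
  then show ?case by (simp add: H_mat_eq_tri_mat numeral_eq_Suc)
next
  case (Suc r)
  then have "n - r = Suc (n - Suc r)" by simp
  with Suc show ?case by (simp add: contraction_tri_mat numeral_eq_Suc del: One_nat_def)
qed

lemma contractible_H_contr:
  assumes "r + 2 \<le> n"
  shows "contractible (H_contr n r) 0 0 1"
proof -
  have "jacobsthal (r + 3) > 0"
    using jacobsthal_Suc_pos[of "r + 2"] by (simp only: numeral_eq_Suc pred_numeral_simps add_Suc_right)
  then show ?thesis
    using assms by (auto simp: H_contr_eq_tri_mat intro!: contractible_tri_mat simp del: One_nat_def)
qed

lemma permanent_H_contr:
  assumes "r < n"
  shows "permanent (H_contr n r) = permanent (H_mat n)"
  using assms
proof (induction r)
  case (Suc r)
  have "dim_row (H_contr n r) = dim_col (H_contr n r)"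
    using Suc.prems by (simp add: H_contr_eq_tri_mat tri_mat_def)
  \<comment> \<open>Here \<open>Suc r < n\<close> leaves at least two rows before the
    contraction.\<close>
  with Suc show ?case by (simp add: permanent_contraction contractible_H_contr del: One_nat_def)
qed simp

theorem theorem1:
  fixes n :: nat
  assumes "n \<ge> 2"
  shows "(\<forall>r \<in> {1..n - 2}. contractible (H_contr n (r - 1)) 0 0 1)
    \<and> permanent (H_mat n) = permanent (H_contr n (n - 2))
    \<and> permanent (H_contr n (n - 2)) = int (jacobsthal (n + 2))"
proof (intro conjI ballI)
  show "contractible (H_contr n (r - 1)) 0 0 1" if "r \<in> {1..n - 2}" for r
    using that by (intro contractible_H_contr) auto
  show per_eq: "permanent (H_mat n) = permanent (H_contr n (n - 2))"
    using assms by (simp add: permanent_H_contr)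
  \<comment> \<open>One contraction further than the statement requires, down to a 1 by 1 matrix.\<close>
  have "permanent (H_mat n) = permanent (H_contr n (n - 1))"
    using assms by (simp add: permanent_H_contr)
  also have "\<dots> = int (jacobsthal (n - 1 + 3))"
    using assms by (simp add: H_contr_eq_tri_mat permanent_tri_mat_1 del: One_nat_def)
  also have "n - 1 + 3 = n + 2" using assms by simp
  finally show "permanent (H_contr n (n - 2)) = int (jacobsthal (n + 2))"
    using per_eq by simp
qed

end
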